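(* For all integers $k\ge1$ and $n\ge1$, $$N^{(k-1)(k-2)\cdots1k}_{32\text{-}1}(n)=\begin{cases}0,&\text{if }k\ge4,\\ B_{n-1}-(n-2)B_{n-3},&\text{if }k=3\text{ and }n\ge3,\\ B_n-(n-1)B_{n-2},&\text{if }k=2\text{ and }n\ge2,\\ B_n,&\text{if }k=1.\end{cases}$$
   Context: A permutation $\pi=\pi_1\cdots\pi_n$ of $\{1,\dots,n\}$ contains the generalized pattern $32\text{-}1$ if there are indices $i,j$ with $i+1<j\le n$ such that $\pi_i\pi_{i+1}\pi_j$ is order-isomorphic to $321$; otherwise it avoids it. A permutation $\pi$ begins with a pattern $p=p_1\cdots p_k$ if $n\ge k$ and $\pi_1\cdots\pi_k$ is order-isomorphic to $p$. The pattern $(k-1)(k-2)\cdots1k$ consists of $k-1,k-2,\dots,1$ in decreasing order followed by $k$ (for $k=1$ it is $1$, for $k=2$ it is $12$, for $k=3$ it is $213$). $N^p_q(n)$ is the number of permutations of $\{1,\dots,n\}$ that avoid $q$ and begin with $p$. $B_m$ is the $m$th Bell number ($B_0=1$). The formula makes no assertion for $k=3$, $n<3$ or $k=2$, $n<2$. *)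

theory Defs
  imports Main "HOL-Library.Disjoint_Sets" "HOL-Combinatorics.Multiset_Permutations"
begin

(* A permutation of {1..n} is its one-line word, i.e. an element of
   permutations_of_set {1..n}.  List positions are counted from 0. *)

definition order_isomorphic :: "nat list \<Rightarrow> nat list \<Rightarrow> bool" where
  "order_isomorphic xs ys \<longleftrightarrow> length xs = length ys \<and>
     (\<forall>i < length xs. \<forall>j < length xs. xs ! i < xs ! j \<longleftrightarrow> ys ! i < ys ! j)"

definition begins_with :: "nat list \<Rightarrow> nat list \<Rightarrow> bool" where
  "begins_with w p \<longleftrightarrow> length p \<le> length w \<and> order_isomorphic (take (length p) w) p"

(* The generalized pattern 32-1: only its first two letters must be adjacent in w. *)
definition contains_32_1 :: "nat list \<Rightarrow> bool" where
  "contains_32_1 w \<longleftrightarrow>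
     (\<exists>i j. i + 1 < j \<and> j < length w \<and> order_isomorphic [w ! i, w ! (i + 1), w ! j] [3, 2, 1])"

(* N^p_q(n); the pattern q to be avoided is given by its containment predicate. *)
definition count_avoiding_beginning :: "(nat list \<Rightarrow> bool) \<Rightarrow> nat list \<Rightarrow> nat \<Rightarrow> nat" where
  "count_avoiding_beginning q p n =
     card {w \<in> permutations_of_set {1..n}. \<not> q w \<and> begins_with w p}"

(* The word (k-1)(k-2)...1k, for k \<ge> 1. *)
definition down_then_max :: "nat \<Rightarrow> nat list" where
  "down_then_max k = rev [1..<k] @ [k]"

definition bell :: "nat \<Rightarrow> nat" where
  "bell m = card {P. partition_on {1..m} P}"

end

theory Submission
  imports Defs
begin

(* A word avoids 32-1 iff nothing after a descent is smaller than the bottom of that descent.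
   Hence, if m is the least letter, the avoiding words are exactly the words u m v with u
   increasing and v avoiding.  The set of letters of u is arbitrary, so avoiding words satisfy the
   same recursion as set partitions, where u corresponds to the block of m with m removed.

   An avoiding word that starts with a descent starts with a m for some letter a, and what follows
   is an arbitrary avoiding word; subtracting these words gives the case k = 2.  Deleting the
   letter m from an avoiding word a m b ... with a < b leaves an arbitrary avoiding word that
   starts with an ascent, which reduces k = 3 to k = 2. *)

section \<open>Pattern containment for words over a finite alphabet\<close>

definition avoiders :: "nat set \<Rightarrow> nat list set" where
  "avoiders S = {w \<in> permutations_of_set S. \<not> contains_32_1 w}"

text \<open>The alphabet is arbitrary because deleting a letter from a word over
  \<open>{1..n}\<close> leaves its other letters unchanged. The case k = 2 uses
  \<open>{1..n}\<close>, the case k = 3 uses \<open>{1..n} - {1}\<close>.\<close>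

definition ascent_avoiders :: "nat set \<Rightarrow> nat list set" where
  "ascent_avoiders S = {w \<in> avoiders S. \<exists>x y v. w = x # y # v \<and> x < y}"

lemma finite_avoiders [simp]: "finite (avoiders S)"
  by (simp add: avoiders_def)

lemma avoiders_iff:
  "w \<in> avoiders S \<longleftrightarrow> set w = S \<and> distinct w \<and> \<not> contains_32_1 w"
  by (auto simp: avoiders_def permutations_of_set_def)

lemma order_isomorphic_321: "order_isomorphic [a, b, c] [3, 2, 1] \<longleftrightarrow> c < b \<and> b < a"
  by (auto simp: order_isomorphic_def less_Suc_eq)

lemma contains_32_1_iff:
  "contains_32_1 w \<longleftrightarrow>
     (\<exists>i j. i + 1 < j \<and> j < length w \<and> w ! j < w ! (i + 1) \<and> w ! (i + 1) < w ! i)"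
  unfolding contains_32_1_def order_isomorphic_321 ..

lemma not_contains_32_1_short [simp]: "\<not> contains_32_1 []" "\<not> contains_32_1 [x]"
  by (auto simp: contains_32_1_iff)

text \<open>The first two letters of an occurrence are adjacent, so an occurrence that uses
  \<open>x\<close> must use \<open>y\<close> as its middle letter; every other occurrence lies in
  \<open>y # ws\<close>.\<close>

lemma contains_32_1_Cons_Cons [simp]:
  "contains_32_1 (x # y # ws) \<longleftrightarrow> (y < x \<and> (\<exists>z\<in>set ws. z < y)) \<or> contains_32_1 (y # ws)"
proof
  assume "contains_32_1 (x # y # ws)"
  then obtain i j where ij: "i + 1 < j" "j < length (x # y # ws)"
      "(x # y # ws) ! j < (x # y # ws) ! (i + 1)" "(x # y # ws) ! (i + 1) < (x # y # ws) ! i"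
    unfolding contains_32_1_iff by blast
  obtain j' where j': "j = Suc (Suc j')"
    using ij(1) by (metis Suc_eq_plus1 less_imp_Suc_add add_Suc)
  show "(y < x \<and> (\<exists>z\<in>set ws. z < y)) \<or> contains_32_1 (y # ws)"
  proof (cases i)
    case 0
    then show ?thesis using ij j' by (auto intro: nth_mem)
  next
    case (Suc i')
    then have "contains_32_1 (y # ws)"
      unfolding contains_32_1_iff using ij j'
      by (intro exI[of _ i'] exI[of _ "Suc j'"]) auto
    then show ?thesis by simp
  qed
next
  assume "(y < x \<and> (\<exists>z\<in>set ws. z < y)) \<or> contains_32_1 (y # ws)"
  then show "contains_32_1 (x # y # ws)"
  proof
    assume "y < x \<and> (\<exists>z\<in>set ws. z < y)"
    then obtain j where "y < x" "j < length ws" "ws ! j < y"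
      by (auto simp: in_set_conv_nth)
    then show ?thesis
      unfolding contains_32_1_iff by (intro exI[of _ 0] exI[of _ "Suc (Suc j)"]) auto
  next
    assume "contains_32_1 (y # ws)"
    then obtain i j where "i + 1 < j" "j < length (y # ws)"
        "(y # ws) ! j < (y # ws) ! (i + 1)" "(y # ws) ! (i + 1) < (y # ws) ! i"
      unfolding contains_32_1_iff by blast
    then show ?thesis
      unfolding contains_32_1_iff by (intro exI[of _ "Suc i"] exI[of _ "Suc j"]) auto
  qed
qed

section \<open>Splitting an avoiding word at its least letter\<close>

lemma contains_32_1_least_Cons:
  assumes "\<forall>z\<in>set v. m < z"
  shows "contains_32_1 (m # v) \<longleftrightarrow> contains_32_1 v"
  using assms by (cases v) auto

text \<open>A descent inside \<open>u\<close> is completed to an occurrence by \<open>m\<close>. A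
  descent from the last letter of \<open>u\<close> to \<open>m\<close> has nothing smaller after it,
  and \<open>m\<close> itself starts no descent, so with \<open>u\<close> sorted only occurrences
  inside \<open>v\<close> remain.\<close>

lemma contains_32_1_append_least:
  assumes "\<forall>z\<in>set u. m < z" "\<forall>z\<in>set v. m < z"
  shows "contains_32_1 (u @ m # v) \<longleftrightarrow> \<not> sorted u \<or> contains_32_1 v"
  using assms
proof (induction u rule: induct_list012)
  case (3 x y zs)
  then have "contains_32_1 ((y # zs) @ m # v) \<longleftrightarrow> \<not> sorted (y # zs) \<or> contains_32_1 v"
    and "m < y" by simp_all
  then show ?case
    \<comment> \<open>If \<open>y < x\<close>, then \<open>m\<close> is the required later letter
      below \<open>y\<close>; otherwise only the tail matters.\<close>
    by (auto simp: sorted2 simp del: sorted_wrt.simps)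
qed (auto simp: contains_32_1_least_Cons)

lemma bij_betw_avoiders:
  fixes S :: "nat set"
  assumes "finite S" "m \<in> S" "\<forall>z\<in>S. m \<le> z"
  shows "bij_betw (\<lambda>(U, v). sorted_list_of_set U @ m # v)
           (SIGMA U:Pow (S - {m}). avoiders (S - {m} - U)) (avoiders S)"
proof -
  let ?f = "\<lambda>(U, v). sorted_list_of_set U @ m # v"
  let ?D = "SIGMA U:Pow (S - {m}). avoiders (S - {m} - U)"
  have fin: "finite U" if "U \<subseteq> S - {m}" for U
    using that assms(1) finite_subset by blast
  have gt: "m < z" if "z \<in> S" "z \<noteq> m" for z
    using assms(3) that by (metis le_neq_implies_less)
  have "inj_on ?f ?D"
  proof (rule inj_onI)
    fix p q assume *: "p \<in> ?D" "q \<in> ?D" "?f p = ?f q"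
    obtain U v U' v' where pq: "p = (U, v)" "q = (U', v')" by (metis surj_pair)
    have "m \<notin> set (sorted_list_of_set U)" "m \<notin> set v"
      using * fin[of U] by (auto simp: pq avoiders_iff)
    then have "sorted_list_of_set U = sorted_list_of_set U' \<and> v = v'"
      \<comment> \<open>Since \<open>m\<close> occurs in neither part, the place where the word is
        cut is unique.\<close>
      using * append_Cons_eq_iff[of m "sorted_list_of_set U" v] by (simp add: pq)
    moreover have "finite U" "finite U'" using * fin by (auto simp: pq)
    ultimately show "p = q" using pq by (metis set_sorted_list_of_set)
  qed
  moreover have "?f p \<in> avoiders S" if D: "p \<in> ?D" for p
  proof -
    obtain U v where p: "p = (U, v)" by (metis surj_pair)
    have U: "U \<subseteq> S - {m}" "finite U" and v: "v \<in> avoiders (S - {m} - U)"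
      using D fin by (auto simp: p)
    have "contains_32_1 (sorted_list_of_set U @ m # v) \<longleftrightarrow>
            \<not> sorted (sorted_list_of_set U) \<or> contains_32_1 v"
      by (rule contains_32_1_append_least) (use U v gt in \<open>auto simp: avoiders_iff\<close>)
    then show ?thesis
      using U v assms(2) by (auto simp: p avoiders_iff)
  qed
  moreover have "w \<in> ?f ` ?D" if w: "w \<in> avoiders S" for w
  proof -
    obtain u v where uv: "w = u @ m # v"
      using w assms(2) by (auto simp: avoiders_iff in_set_conv_decomp)
    have S: "S = insert m (set u \<union> set v)" and d: "distinct (u @ m # v)"
      using w by (auto simp: avoiders_iff uv)
    have "contains_32_1 (u @ m # v) \<longleftrightarrow> \<not> sorted u \<or> contains_32_1 v"
      by (rule contains_32_1_append_least) (use S d gt in auto)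
    then have u: "sorted u" and v: "\<not> contains_32_1 v"
      using w by (auto simp: avoiders_iff uv)
    have "sorted_list_of_set (set u) = u"
      using u d by (simp add: sorted_list_of_set.idem_if_sorted_distinct)
    then have "w = ?f (set u, v)" by (simp add: uv)
    moreover have "(set u, v) \<in> ?D"
      using S d v by (auto simp: avoiders_iff)
    ultimately show ?thesis by blast
  qed
  ultimately show ?thesis by (auto simp: bij_betw_def)
qed

section \<open>The same recursion for set partitions, and Bell numbers of arbitrary finite
  sets\<close>

lemma bij_betw_partitions:
  assumes "m \<in> S"
  shows "bij_betw (\<lambda>(U, P). insert (insert m U) P)
           (SIGMA U:Pow (S - {m}). {P. partition_on (S - {m} - U) P}) {P. partition_on S P}"
proof -
  let ?f = "\<lambda>(U, P). insert (insert m U) P"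
  let ?D = "SIGMA U:Pow (S - {m}). {P. partition_on (S - {m} - U) P}"
  \<comment> \<open>The removed block \<open>insert m U\<close> is nonempty even for
    \<open>U = {}\<close>, where it is the singleton block of \<open>m\<close>.\<close>
  have split: "partition_on S (insert (insert m U) P) \<longleftrightarrow> partition_on (S - {m} - U) P"
    if "U \<subseteq> S - {m}" "disjnt (insert m U) (\<Union>P)" for U P
    using partition_on_insert[OF that(2), of S] that(1) assms
    by (auto simp: Diff_insert2[symmetric] insert_commute)
  have "inj_on ?f ?D"
  proof (rule inj_onI)
    fix p q assume *: "p \<in> ?D" "q \<in> ?D" "?f p = ?f q"
    obtain U P U' P' where pq: "p = (U, P)" "q = (U', P')" by (metis surj_pair)
    have U: "m \<notin> U" "m \<notin> U'" and P: "m \<notin> \<Union>P" "m \<notin> \<Union>P'"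
      using * by (auto simp: pq dest!: partition_onD1)
    have eq: "insert (insert m U) P = insert (insert m U') P'" using * by (simp add: pq)
    \<comment> \<open>On each side this is the only block containing \<open>m\<close>.\<close>
    have "insert m U = insert m U'"
      using eq P by (metis UnionI insertE insertI1)
    then have "U = U'" using U insert_ident by metis
    moreover have "P = P'"
      using eq P \<open>U = U'\<close> by (metis UnionI insertI1 insert_ident)
    ultimately show "p = q" using pq by simp
  qed
  moreover have "partition_on S (?f p)" if D: "p \<in> ?D" for p
  proof -
    obtain U P where p: "p = (U, P)" by (metis surj_pair)
    have "U \<subseteq> S - {m}" "partition_on (S - {m} - U) P" using D by (auto simp: p)
    moreover from this have "disjnt (insert m U) (\<Union>P)"
      by (auto simp: disjnt_iff dest!: partition_onD1)
    ultimately show ?thesis using split by (simp add: p)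
  qed
  moreover have "Q \<in> ?f ` ?D" if Q: "partition_on S Q" for Q
  proof -
    obtain B where B: "B \<in> Q" "m \<in> B" using Q assms by (auto dest: partition_onD1)
    have "Q = insert (insert m (B - {m})) (Q - {B})" using B by (simp add: insert_absorb)
    moreover have "B - {m} \<subseteq> S - {m}" using B Q by (auto dest: partition_onD1)
    moreover have "disjnt (insert m (B - {m})) (\<Union>(Q - {B}))"
      using partition_onD2[OF Q] B by (auto simp: disjnt_iff disjoint_def)
    ultimately have "partition_on (S - {m} - (B - {m})) (Q - {B})"
      using split Q by metis
    then have "(B - {m}, Q - {B}) \<in> ?D" using \<open>B - {m} \<subseteq> S - {m}\<close> by simp
    then show ?thesis using \<open>Q = _\<close> by (intro image_eqI[of _ _ "(B - {m}, Q - {B})"]) auto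
  qed
  ultimately show ?thesis by (auto simp: bij_betw_def)
qed

text \<open>Partitions are transported along \<open>f\<close> block by block; applied to
  \<open>f\<close> and to its inverse this yields equality.\<close>

lemma card_partitions_le:
  assumes "bij_betw f S T" "finite S"
  shows "card {P. partition_on S P} \<le> card {P. partition_on T P}"
proof (rule card_inj_on_le)
  have inj: "inj_on f S" and T: "f ` S = T" using assms by (auto simp: bij_betw_def)
  \<comment> \<open>The inner image acts on blocks, the outer one on families of blocks, hence the
    double power set.\<close>
  have "inj_on ((`) ((`) f)) (Pow (Pow S))"
    using inj by (intro inj_on_image_Pow)
  then show "inj_on ((`) ((`) f)) {P. partition_on S P}"
    by (rule inj_on_subset) (auto dest: partition_onD1)
  show "(`) ((`) f) ` {P. partition_on S P} \<subseteq> {P. partition_on T P}"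
  proof clarify
    fix P assume P: "partition_on S P"
    then have "inj_on f (\<Union>P)" using inj by (auto dest: partition_onD1)
    then have "disjoint ((`) f ` P)"
      using partition_onD2[OF P] by (rule disjoint_image)
    moreover have "\<Union>((`) f ` P) = T" using T partition_onD1[OF P] by blast
    ultimately show "partition_on T ((`) f ` P)"
      using partition_onD3[OF P] by (auto simp: partition_on_def)
  qed
  show "finite {P. partition_on T P}"
    using assms T by (intro finitely_many_partition_on) blast
qed

lemma card_partitions:
  assumes "finite S"
  shows "card {P. partition_on S P} = bell (card S)"
proof -
  obtain f where f: "bij_betw f S {1..card S}"
    using assms by (metis card_atLeastAtMost diff_Suc_1 finite_atLeastAtMost finite_same_card_bij)
  show ?thesis
    unfolding bell_def
    using card_partitions_le[OF f assms] card_partitions_le[OF bij_betw_inv_into[OF f]]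
    by (intro antisym) auto
qed

text \<open>Both bijections have the same index set \<open>Pow (S - {m})\<close>, and their fibres
  over \<open>U\<close> have equal size by induction on the alphabet.\<close>

lemma card_avoiders:
  assumes "finite S"
  shows "card (avoiders S) = bell (card S)"
  using assms
proof (induction S rule: finite_psubset_induct)
  case (psubset S)
  show ?case
  proof (cases "S = {}")
    case True
    then show ?thesis
      \<comment> \<open>Both sides are 1: the empty word and the empty partition.\<close>
      by (simp add: avoiders_def bell_def partition_on_empty conj_commute cong: conj_cong)
  next
    case False
    define m where "m = Min S"
    have m: "m \<in> S" "\<forall>z\<in>S. m \<le> z" using psubset False by (auto simp: m_def)
    have fin: "finite (S - {m} - U)" for U using psubset by simp
    have "card (avoiders S) = (\<Sum>U\<in>Pow (S - {m}). card (avoiders (S - {m} - U)))"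
      using bij_betw_same_card[OF bij_betw_avoiders[OF psubset(1) m]] psubset(1) by simp
    also have "\<dots> = (\<Sum>U\<in>Pow (S - {m}). card {P. partition_on (S - {m} - U) P})"
    proof (rule sum.cong)
      fix U
      have "S - {m} - U \<subset> S" using m by blast
      then show "card (avoiders (S - {m} - U)) = card {P. partition_on (S - {m} - U) P}"
        using psubset(2) card_partitions[OF fin] by simp
    qed simp
    also have "\<dots> = card {P. partition_on S P}"
      using bij_betw_same_card[OF bij_betw_partitions[OF m(1)]] psubset(1)
        finitely_many_partition_on[OF fin] by simp
    finally show ?thesis using card_partitions[OF psubset(1)] by simp
  qed
qed

section \<open>Avoiding words by their first two letters\<close>

lemma descent_avoider_bottom:
  assumes "m \<in> S" "\<forall>z\<in>S. m \<le> z" "x # y # v \<in> avoiders S" "y < x"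
  shows "y = m"
proof (rule antisym)
  \<comment> \<open>A later letter below \<open>y\<close> would complete the initial descent to an
    occurrence.\<close>
  have S: "S = {x, y} \<union> set v" and "\<forall>z\<in>set v. y \<le> z"
    using assms(3,4) by (auto simp: avoiders_iff not_less)
  then show "y \<le> m" using assms(1,4) by auto
  show "m \<le> y" using S assms(2) by auto
qed

text \<open>This is the splitting at \<open>m\<close> with \<open>u = [x]\<close>: a single letter
  is sorted, so the only restriction falls on \<open>v\<close>.\<close>

lemma second_least_avoider_iff:
  assumes "m \<in> S" "\<forall>z\<in>S. m \<le> z"
  shows "x # m # v \<in> avoiders S \<longleftrightarrow> x \<in> S - {m} \<and> v \<in> avoiders (S - {m, x})"
proof -
  have gt: "m < z" if "z \<in> S" "z \<noteq> m" for z
    using assms(2) that by (metis le_neq_implies_less)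
  have "set (x # m # v) = S \<and> distinct (x # m # v) \<longleftrightarrow>
          x \<in> S - {m} \<and> set v = S - {m, x} \<and> distinct v"
    using assms(1) by auto
  moreover have "contains_32_1 (x # m # v) \<longleftrightarrow> contains_32_1 v"
    if "x \<in> S - {m}" "set v = S - {m, x}"
    using contains_32_1_append_least[of "[x]" m v] that gt by auto
  ultimately show ?thesis unfolding avoiders_iff by blast
qed

lemma card_ascent_avoiders:
  assumes "finite S" "card S \<ge> 2"
  shows "int (card (ascent_avoiders S)) =
           int (bell (card S)) - (int (card S) - 1) * int (bell (card S - 2))"
proof -
  define m where "m = Min S"
  have "S \<noteq> {}" using assms by auto
  then have m: "m \<in> S" "\<forall>z\<in>S. m \<le> z" using assms by (auto simp: m_def)
  \<comment> \<open>\<open>D\<close> collects the avoiding words that start with a descent: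
    \<open>card S - 1\<close> choices of the first letter, then any avoiding word on the remaining
    \<open>card S - 2\<close> letters.\<close>
  define D where "D = (\<lambda>(a, v). a # m # v) ` (SIGMA a:S - {m}. avoiders (S - {m, a}))"
  have "card D = (\<Sum>a\<in>S - {m}. card (avoiders (S - {m, a})))"
    unfolding D_def using assms by (subst card_image) (auto simp: inj_on_def)
  also have "\<dots> = (\<Sum>a\<in>S - {m}. bell (card S - 2))"
  proof (rule sum.cong)
    fix a assume "a \<in> S - {m}"
    then have "card (S - {m, a}) = card S - 2"
      using assms(1) m(1) by (subst card_Diff_subset) auto
    then show "card (avoiders (S - {m, a})) = bell (card S - 2)"
      using assms(1) by (simp add: card_avoiders)
  qed simp
  finally have card_D: "card D = (card S - 1) * bell (card S - 2)"
    using m assms by simp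
  have "avoiders S = ascent_avoiders S \<union> D"
  proof (intro subset_antisym subsetI)
    fix w assume w: "w \<in> avoiders S"
    then have "length w \<ge> 2"
      using assms by (auto simp: avoiders_iff dest: distinct_card)
    then obtain x y v where xyv: "w = x # y # v"
      by (auto simp: Suc_le_length_iff numeral_2_eq_2)
    then have "x \<noteq> y" using w by (auto simp: avoiders_iff)
    then consider "x < y" | "y < x" by linarith
    then show "w \<in> ascent_avoiders S \<union> D"
    proof cases
      case 1
      then show ?thesis using w xyv by (auto simp: ascent_avoiders_def)
    next
      case 2
      then show ?thesis
        using w xyv descent_avoider_bottom[OF m, of x y v] second_least_avoider_iff[OF m, of x v]
        by (auto simp: D_def)
    qed
  next
    fix w assume "w \<in> ascent_avoiders S \<union> D"
    then show "w \<in> avoiders S"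
      using second_least_avoider_iff[OF m] by (auto simp: D_def ascent_avoiders_def)
  qed
  \<comment> \<open>In \<open>D\<close> the second letter is the minimum, so it cannot exceed the
    first.\<close>
  moreover have "ascent_avoiders S \<inter> D = {}"
    using m(2) by (auto simp: D_def ascent_avoiders_def dest: leD)
  moreover have "finite D" "finite (ascent_avoiders S)"
    using assms by (auto simp: D_def ascent_avoiders_def)
  ultimately have "card (avoiders S) = card (ascent_avoiders S) + card D"
    by (simp add: card_Un_disjoint)
  then have "int (bell (card S)) = int (card (ascent_avoiders S)) + int (card D)"
    using card_avoiders[OF assms(1)] by linarith
  then show ?thesis using card_D assms(2) by (simp add: of_nat_diff)
qed

text \<open>Inserting \<open>m\<close> in second place creates a descent with nothing smaller after
  it, and removing it leaves the ascent from \<open>x\<close> to \<open>z\<close>. Neither initial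
  pair starts an occurrence, so both words avoid 32-1 exactly when \<open>z # v\<close>
  does.\<close>

lemma bij_betw_ascent_avoiders:
  assumes "m \<in> S" "\<forall>z\<in>S. m \<le> z"
  shows "bij_betw (\<lambda>w. hd w # m # tl w) (ascent_avoiders (S - {m}))
           {w \<in> avoiders S. \<exists>x y z v. w = x # y # z # v \<and> y < x \<and> x < z}"
proof -
  have *: "x # z # v \<in> avoiders (S - {m}) \<longleftrightarrow> x # m # z # v \<in> avoiders S" if "x < z" for x z v
  proof -
    have "x # m # z # v \<in> avoiders S \<longleftrightarrow> x \<in> S - {m} \<and> z # v \<in> avoiders (S - {m, x})"
      by (rule second_least_avoider_iff[OF assms])
    also have "\<dots> \<longleftrightarrow> x # z # v \<in> avoiders (S - {m})"
      using that by (auto simp: avoiders_iff)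
    finally show ?thesis by simp
  qed
  have "inj_on (\<lambda>w. hd w # m # tl w) (ascent_avoiders (S - {m}))"
    by (auto simp: inj_on_def ascent_avoiders_def)
  moreover have "hd w # m # tl w \<in> avoiders S \<and>
      (\<exists>x y z v. hd w # m # tl w = x # y # z # v \<and> y < x \<and> x < z)"
    if "w \<in> ascent_avoiders (S - {m})" for w
  proof -
    obtain x z v where w: "w = x # z # v" "x < z" "w \<in> avoiders (S - {m})"
      using \<open>w \<in> _\<close> by (auto simp: ascent_avoiders_def)
    then have "m < x" using assms by (auto simp: avoiders_iff le_less)
    then show ?thesis using w * by auto
  qed
  moreover have "w \<in> (\<lambda>w. hd w # m # tl w) ` ascent_avoiders (S - {m})"
    if "w \<in> avoiders S" "w = x # y # z # v" "y < x" "x < z" for w x y z v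
  proof (rule image_eqI[of _ _ "x # z # v"])
    \<comment> \<open>The bottom of an initial descent is forced, so deleting the second letter
      deletes \<open>m\<close>.\<close>
    have "y = m" using descent_avoider_bottom[OF assms] that by blast
    then show "w = hd (x # z # v) # m # tl (x # z # v)" using that by simp
    show "x # z # v \<in> ascent_avoiders (S - {m})"
      using * that \<open>y = m\<close> by (auto simp: ascent_avoiders_def)
  qed
  ultimately show ?thesis unfolding bij_betw_def by blast
qed

section \<open>The prefixes \<open>down_then_max k\<close> and the four cases\<close>

lemma begins_with_1: "begins_with w [1] \<longleftrightarrow> w \<noteq> []"
  by (cases w) (auto simp: begins_with_def order_isomorphic_def)

lemma begins_with_12: "begins_with w [1, 2] \<longleftrightarrow> (\<exists>x y v. w = x # y # v \<and> x < y)"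
  \<comment> \<open>This rule serves only to separate words of length 0, 1 and at least 2.\<close>
  by (cases w rule: remdups_adj.cases)
    (auto simp: begins_with_def order_isomorphic_def less_Suc_eq)

lemma begins_with_213:
  "begins_with w [2, 1, 3] \<longleftrightarrow> (\<exists>x y z v. w = x # y # z # v \<and> y < x \<and> x < z)"
proof (cases "length w \<ge> 3")
  case True
  then obtain x y z v where "w = x # y # z # v"
    by (auto simp: Suc_le_length_iff numeral_3_eq_3)
  then show ?thesis by (auto simp: begins_with_def order_isomorphic_def less_Suc_eq)
qed (auto simp: begins_with_def)

text \<open>For \<open>k \<ge> 4\<close> the decreasing run of the prefix has at least three
  letters, and its first three already form an occurrence at positions 0, 1, 2.\<close>

lemma contains_32_1_if_begins_with:
  assumes "k \<ge> 4" "begins_with w (down_then_max k)"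
  shows "contains_32_1 w"
proof -
  have len: "length (down_then_max k) = k" using assms by (simp add: down_then_max_def)
  have nth: "down_then_max k ! i = k - 1 - i" if "i < k - 1" for i
    using that by (simp add: down_then_max_def nth_append rev_nth)
  have "w ! i < w ! j \<longleftrightarrow> down_then_max k ! i < down_then_max k ! j" if "i < k" "j < k" for i j
    using assms(2) that len by (simp add: begins_with_def order_isomorphic_def)
  then have "w ! 2 < w ! 1" "w ! 1 < w ! 0"
    using assms(1) by (simp_all add: nth)
  moreover have "2 < length w" using assms len by (simp add: begins_with_def)
  ultimately show ?thesis
    unfolding contains_32_1_iff by (intro exI[of _ 0] exI[of _ 2]) auto
qed

lemma count_avoiding_beginning_eq:
  "count_avoiding_beginning contains_32_1 p n = card {w \<in> avoiders {1..n}. begins_with w p}"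
  by (simp add: count_avoiding_beginning_def avoiders_def conj_assoc)

theorem proposition21:
  fixes k n :: nat
  assumes "k \<ge> 1" and "n \<ge> 1"
  shows "(k \<ge> 4 \<longrightarrow>
           count_avoiding_beginning contains_32_1 (down_then_max k) n = 0)
    \<and> (k = 3 \<and> n \<ge> 3 \<longrightarrow>
           int (count_avoiding_beginning contains_32_1 (down_then_max k) n)
             = int (bell (n - 1)) - (int n - 2) * int (bell (n - 3)))
    \<and> (k = 2 \<and> n \<ge> 2 \<longrightarrow>
           int (count_avoiding_beginning contains_32_1 (down_then_max k) n)
             = int (bell n) - (int n - 1) * int (bell (n - 2)))
    \<and> (k = 1 \<longrightarrow>
           count_avoiding_beginning contains_32_1 (down_then_max k) n = bell n)"
proof (intro conjI impI)
  assume "k \<ge> 4"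
  then have "{w \<in> avoiders {1..n}. begins_with w (down_then_max k)} = {}"
    using contains_32_1_if_begins_with by (auto simp: avoiders_iff)
  then show "count_avoiding_beginning contains_32_1 (down_then_max k) n = 0"
    unfolding count_avoiding_beginning_eq by simp
next
  assume *: "k = 3 \<and> n \<ge> 3"
  then have p: "down_then_max k = [2, 1, 3]"
    by (simp add: down_then_max_def upt_rec)
  have "count_avoiding_beginning contains_32_1 (down_then_max k) n =
          card (ascent_avoiders ({1..n} - {1}))"
    unfolding count_avoiding_beginning_eq p begins_with_213
    by (rule bij_betw_same_card[symmetric], rule bij_betw_ascent_avoiders) (use * in auto)
  moreover have "card ({1..n} - {1}) = n - 1" using assms by simp
  ultimately show "int (count_avoiding_beginning contains_32_1 (down_then_max k) n)
             = int (bell (n - 1)) - (int n - 2) * int (bell (n - 3))"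
    \<comment> \<open>The alphabet has \<open>n - 1\<close> letters, so the k = 2 formula is used
      with \<open>n\<close> lowered by one.\<close>
    using * card_ascent_avoiders[of "{1..n} - {1}"]
    by (simp add: of_nat_diff numeral_3_eq_3 le_diff_conv2)
next
  assume *: "k = 2 \<and> n \<ge> 2"
  then have p: "down_then_max k = [1, 2]"
    by (simp add: down_then_max_def upt_rec)
  show "int (count_avoiding_beginning contains_32_1 (down_then_max k) n)
             = int (bell n) - (int n - 1) * int (bell (n - 2))"
    unfolding count_avoiding_beginning_eq p begins_with_12
    using * card_ascent_avoiders[of "{1..n}"] by (simp add: ascent_avoiders_def)
next
  assume "k = 1"
  then have p: "down_then_max k = [1]" by (simp add: down_then_max_def)
  \<comment> \<open>As \<open>n \<ge> 1\<close>, the alphabet is nonempty and so is every word on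
    it.\<close>
  have "{w \<in> avoiders {1..n}. w \<noteq> []} = avoiders {1..n}"
    using assms by (auto simp: avoiders_iff)
  then show "count_avoiding_beginning contains_32_1 (down_then_max k) n = bell n"
    unfolding count_avoiding_beginning_eq p begins_with_1
    using card_avoiders[of "{1..n}"] by simp
qed

end
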